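(* Let $\gamma\in[0,1)$ and $\alpha\in\left(-\frac12+\frac\gamma2,\ \frac12+\frac\gamma2\right)$, and let $X$ be the generalized fractional Brownian motion with parameters $(\alpha,\gamma)$. Then $X$ is long-range dependent (in the sense of self-similar processes, as defined in the context) if and only if $\alpha>0$. In particular, when $\gamma=0$, the fractional Brownian motion $B^H$ is long-range dependent if $H=\alpha+\frac12>\frac12$.
   Context: Let $B(\mathrm du)$ be a Gaussian random measure on $\mathbb R$ with Lebesgue control measure (two-sided Brownian motion). The generalized fractional Brownian motion is $$X(t)=c\int_{\mathbb R}\left((t-u)_+^{\alpha}-(-u)_+^{\alpha}\right)|u|^{-\gamma/2}B(\mathrm du),\qquad t\ge0$$ (for $\alpha=0$ the convention is $(t-u)_+^0-(-u)_+^0=\mathbf 1_{\{0<u<t\}}$), with $c=\left(\int_0^1(1-v)^{2\alpha}v^{-\gamma}\mathrm dv+\int_0^\infty[(1+v)^\alpha-v^\alpha]^2v^{-\gamma}\mathrm dv\right)^{-1/2}$. It is a centered Gaussian process, self-similar with Hurst index $H=\alpha-\frac\gamma2+\frac12\in(0,1)$; for $\gamma=0$ it is the fractional Brownian motion $B^H$. Long-range dependence: for a self-similar process $\{\xi(t),t\ge0\}$ with Hurst index $H$ and $\xi(0)=0$, its Lamperti transform is $\eta(t):=e^{-Ht}\xi(e^t)$, $t\in\mathbb R$, which is stationary; write $C_\eta(t):=\mathbb E[\eta(t+s)\eta(s)]$ for its covariance function. The process $\xi$ is called long-range dependent if $$\lim_{t\to\infty}\frac1t\log|C_\eta(t)|+H>0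 .$$ *)

theory Defs
  imports "HOL-Probability.Probability"
begin

text \<open>A constant random variable 0 counts as (degenerate) centered Gaussian.\<close>

definition centered_gaussian :: "'a measure \<Rightarrow> ('a \<Rightarrow> real) \<Rightarrow> bool" where
  "centered_gaussian M Y \<longleftrightarrow>
     Y \<in> borel_measurable M \<and>
     ((AE \<omega> in M. Y \<omega> = 0) \<or>
      (\<exists>\<sigma>>0. distributed M lborel Y (\<lambda>x. ennreal (normal_density 0 \<sigma> x))))"

text \<open>A Gaussian random measure with control measure \<open>N\<close>: a jointly Gaussian centered family
  indexed by the measurable sets of finite \<open>N\<close>-measure, with covariance
  \<open>E[B(A) B(A')] = N(A \<inter> A')\<close>.\<close>

definition gaussian_random_measure ::
  "'a measure \<Rightarrow> 'b measure \<Rightarrow> ('b set \<Rightarrow> 'a \<Rightarrow> real) \<Rightarrow> bool" where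
  "gaussian_random_measure M N B \<longleftrightarrow>
     prob_space M \<and>
     (\<forall>J a. finite J \<longrightarrow> J \<subseteq> {A \<in> sets N. emeasure N A < \<infinity>} \<longrightarrow>
        centered_gaussian M (\<lambda>\<omega>. \<Sum>A\<in>J. a A * B A \<omega>)) \<and>
     (\<forall>A\<in>sets N. \<forall>A'\<in>sets N. emeasure N A < \<infinity> \<longrightarrow> emeasure N A' < \<infinity> \<longrightarrow>
        integrable M (\<lambda>\<omega>. B A \<omega> * B A' \<omega>) \<and>
        (\<integral>\<omega>. B A \<omega> * B A' \<omega> \<partial>M) = measure N (A \<inter> A'))"

definition simple_wiener_integral ::
  "'b measure \<Rightarrow> ('b set \<Rightarrow> 'a \<Rightarrow> real) \<Rightarrow> ('b \<Rightarrow> real) \<Rightarrow> 'a \<Rightarrow> real" where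
  "simple_wiener_integral N B s \<omega> =
     (\<Sum>y\<in>s ` space N - {0}. y * B (s -` {y} \<inter> space N) \<omega>)"

text \<open>\<open>Y\<close> is a version of the integral of \<open>f\<close> against \<open>B\<close>: the mean-square limit of the integrals
  of simple functions (each supported on a set of finite measure) that tend to \<open>f\<close> in \<open>L\<^sup>2(N)\<close>.\<close>

definition has_wiener_integral ::
  "'a measure \<Rightarrow> 'b measure \<Rightarrow> ('b set \<Rightarrow> 'a \<Rightarrow> real) \<Rightarrow> ('b \<Rightarrow> real) \<Rightarrow> ('a \<Rightarrow> real) \<Rightarrow> bool" where
  "has_wiener_integral M N B f Y \<longleftrightarrow>
     f \<in> borel_measurable N \<and> Y \<in> borel_measurable M \<and>
     (\<exists>s :: nat \<Rightarrow> 'b \<Rightarrow> real.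
        (\<forall>n. simple_function N (s n) \<and> emeasure N {x\<in>space N. s n x \<noteq> 0} < \<infinity>) \<and>
        (\<lambda>n. \<integral>\<^sup>+ x. ennreal ((s n x - f x)\<^sup>2) \<partial>N) \<longlonglongrightarrow> 0 \<and>
        (\<lambda>n. \<integral>\<^sup>+ \<omega>. ennreal ((simple_wiener_integral N B (s n) \<omega> - Y \<omega>)\<^sup>2) \<partial>M) \<longlonglongrightarrow> 0)"

text \<open>Since \<open>0 powr a = 0\<close> for every \<open>a\<close>, \<open>pos_part_powr x a\<close> vanishes for \<open>x \<le> 0\<close>, also when
  \<open>a \<le> 0\<close>. In particular, for \<open>\<alpha> = 0\<close> and \<open>t \<ge> 0\<close> the kernel below is \<open>\<bar>u\<bar> powr (-\<gamma>/2)\<close> times the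
  indicator of \<open>0 < u < t\<close> (at \<open>u = 0\<close> the factor \<open>\<bar>u\<bar> powr (-\<gamma>/2)\<close> is 0).\<close>

definition pos_part_powr :: "real \<Rightarrow> real \<Rightarrow> real" where
  "pos_part_powr x a = max x 0 powr a"

definition gfbm_kernel :: "real \<Rightarrow> real \<Rightarrow> real \<Rightarrow> real \<Rightarrow> real" where
  "gfbm_kernel \<alpha> \<gamma> t u =
     (pos_part_powr (t - u) \<alpha> - pos_part_powr (- u) \<alpha>) * \<bar>u\<bar> powr (- \<gamma> / 2)"

definition gfbm_const :: "real \<Rightarrow> real \<Rightarrow> real" where
  "gfbm_const \<alpha> \<gamma> =
     ((LINT v:{0<..<1}|lborel. (1 - v) powr (2 * \<alpha>) * v powr (- \<gamma>)) +
      (LINT v:{0<..}|lborel. ((1 + v) powr \<alpha> - v powr \<alpha>)\<^sup>2 * v powr (- \<gamma>))) powr (- 1 / 2)"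

definition generalized_fBm ::
  "'a measure \<Rightarrow> (real set \<Rightarrow> 'a \<Rightarrow> real) \<Rightarrow> real \<Rightarrow> real \<Rightarrow> (real \<Rightarrow> 'a \<Rightarrow> real) \<Rightarrow> bool" where
  "generalized_fBm M B \<alpha> \<gamma> X \<longleftrightarrow>
     (\<forall>t\<ge>0. \<exists>I. has_wiener_integral M lborel B (gfbm_kernel \<alpha> \<gamma> t) I \<and>
                (\<forall>\<omega>\<in>space M. X t \<omega> = gfbm_const \<alpha> \<gamma> * I \<omega>))"

text \<open>Fractional Brownian motion with Hurst index \<open>H\<close> in its moving average (Mandelbrot--Van Ness)
  form, i.e. with \<open>\<gamma> = 0\<close> and \<open>H = \<alpha> + 1/2\<close>.\<close>

definition fractional_BM ::
  "'a measure \<Rightarrow> (real set \<Rightarrow> 'a \<Rightarrow> real) \<Rightarrow> real \<Rightarrow> (real \<Rightarrow> 'a \<Rightarrow> real) \<Rightarrow> bool" where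
  "fractional_BM M B H Y \<longleftrightarrow> generalized_fBm M B (H - 1 / 2) 0 Y"

definition lamperti :: "real \<Rightarrow> (real \<Rightarrow> 'a \<Rightarrow> real) \<Rightarrow> real \<Rightarrow> 'a \<Rightarrow> real" where
  "lamperti H \<xi> t \<omega> = exp (- H * t) * \<xi> (exp t) \<omega>"

text \<open>\<open>C\<close> is the covariance function of the (centered, stationary) process \<open>\<eta>\<close>; that
  \<open>E[\<eta>(t + s) \<eta>(s)]\<close> does not depend on \<open>s\<close> is part of the definition.\<close>

definition has_covariance_function ::
  "'a measure \<Rightarrow> (real \<Rightarrow> 'a \<Rightarrow> real) \<Rightarrow> (real \<Rightarrow> real) \<Rightarrow> bool" where
  "has_covariance_function M \<eta> C \<longleftrightarrow>
     (\<forall>s t. integrable M (\<lambda>\<omega>. \<eta> (t + s) \<omega> * \<eta> s \<omega>) \<and>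
            (\<integral>\<omega>. \<eta> (t + s) \<omega> * \<eta> s \<omega> \<partial>M) = C t)"

text \<open>Long-range dependence of a self-similar process \<open>\<xi>\<close> with Hurst index \<open>H\<close>. The condition
  \<open>C t \<noteq> 0\<close> accounts for \<open>log 0 = - \<infinity>\<close>, whereas \<open>ln 0 = 0\<close> here: if \<open>C\<close> had arbitrarily large
  zeros, the limit could not be positive. It cannot be \<open>+ \<infinity>\<close> either, since \<open>\<bar>C t\<bar> \<le> C 0\<close>, so a
  real limit suffices.\<close>

definition long_range_dependent ::
  "'a measure \<Rightarrow> real \<Rightarrow> (real \<Rightarrow> 'a \<Rightarrow> real) \<Rightarrow> bool" where
  "long_range_dependent M H \<xi> \<longleftrightarrow>
     (\<exists>C. has_covariance_function M (lamperti H \<xi>) C \<and>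
          (\<forall>\<^sub>F t in at_top. C t \<noteq> 0) \<and>
          (\<exists>L>0. ((\<lambda>t. 1 / t * ln \<bar>C t\<bar> + H) \<longlongrightarrow> L) at_top))"

end

theory Submission
  imports Defs
begin

text \<open>By the Wiener isometry \<open>E[X(s) X(t)] = c\<^sup>2 K(s,t)\<close>, where \<open>K(s,t)\<close> is the \<open>L\<^sup>2\<close> inner product of the
  kernels, and \<open>K\<close> is homogeneous of degree \<open>2H\<close>. Hence the Lamperti transform has covariance
  \<open>C(t) = c\<^sup>2 exp(-Ht) K(exp t, 1)\<close>, and the limit in the definition of long-range dependence is the
  growth exponent of \<open>T \<mapsto> K(T,1)\<close>. For \<open>\<alpha> > 0\<close> this exponent is \<open>max \<alpha> (2\<alpha> - \<gamma>)\<close>: the first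
  term comes from \<open>u \<in> (0,1)\<close>, the second from \<open>u \<approx> -T\<close>, and the matching upper bound, up to
  \<open>T\<^sup>\<epsilon>\<close>, from the interpolation \<open>(T+v)\<^sup>\<alpha> - v\<^sup>\<alpha> \<le> T\<^sup>\<alpha> (T/v)\<^sup>d\<close>. For \<open>\<alpha> \<le> 0\<close> the function
  \<open>K(T,1)\<close> is bounded in \<open>T \<ge> 1\<close>, so the limit cannot be positive.\<close>

section \<open>Square-integrable limits and the Wiener isometry\<close>

lemma integrable_product_of_squares:
  fixes f g :: "'a \<Rightarrow> real"
  assumes [measurable]: "f \<in> borel_measurable M" "g \<in> borel_measurable M"
    and f2: "integrable M (\<lambda>x. (f x)\<^sup>2)" and g2: "integrable M (\<lambda>x. (g x)\<^sup>2)"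
  shows "integrable M (\<lambda>x. f x * g x)"
proof (rule Bochner_Integration.integrable_bound)
  show "integrable M (\<lambda>x. (f x)\<^sup>2 + (g x)\<^sup>2)"
    using f2 g2 by simp
  have "\<bar>x * y\<bar> \<le> x\<^sup>2 + y\<^sup>2" for x y :: real
  proof -
    have "2 * \<bar>x * y\<bar> \<le> x\<^sup>2 + y\<^sup>2"
      using sum_squares_bound[of "\<bar>x\<bar>" "\<bar>y\<bar>"] by (simp add: abs_mult)
    then show ?thesis by linarith
  qed
  then show "AE x in M. norm (f x * g x) \<le> norm ((f x)\<^sup>2 + (g x)\<^sup>2)"
    by simp
qed simp

text \<open>For every t the integral of (t f + g)^2 is nonnegative; evaluated at its minimiser t = -
  P / F, this quadratic in t gives P^2 \<le> F G.\<close>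

lemma Cauchy_Schwarz_integral:
  fixes f g :: "'a \<Rightarrow> real"
  assumes [measurable]: "f \<in> borel_measurable M" "g \<in> borel_measurable M"
    and f2: "integrable M (\<lambda>x. (f x)\<^sup>2)" and g2: "integrable M (\<lambda>x. (g x)\<^sup>2)"
  shows "\<bar>\<integral>x. f x * g x \<partial>M\<bar> \<le> sqrt (\<integral>x. (f x)\<^sup>2 \<partial>M) * sqrt (\<integral>x. (g x)\<^sup>2 \<partial>M)"
proof -
  define F G P where "F = (\<integral>x. (f x)\<^sup>2 \<partial>M)" and "G = (\<integral>x. (g x)\<^sup>2 \<partial>M)"
    and "P = (\<integral>x. f x * g x \<partial>M)"
  note fg = integrable_product_of_squares[OF assms]
  have q: "0 \<le> t\<^sup>2 * F + 2 * t * P + G" for t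
  proof -
    have "0 \<le> (\<integral>x. (t * f x + g x)\<^sup>2 \<partial>M)" by simp
    also have "(\<lambda>x. (t * f x + g x)\<^sup>2) = (\<lambda>x. t\<^sup>2 * (f x)\<^sup>2 + 2 * t * (f x * g x) + (g x)\<^sup>2)"
      by (auto simp: power2_eq_square algebra_simps)
    also have "(\<integral>x. t\<^sup>2 * (f x)\<^sup>2 + 2 * t * (f x * g x) + (g x)\<^sup>2 \<partial>M) = t\<^sup>2 * F + 2 * t * P + G"
      using f2 g2 fg by (simp add: F_def G_def P_def)
    finally show ?thesis .
  qed
  have F0: "F \<ge> 0" and G0: "G \<ge> 0" by (simp_all add: F_def G_def)
  have "P\<^sup>2 \<le> F * G"
  proof (cases "F = 0")
    case True
    have "P = 0"
    proof (rule ccontr)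
      assume "P \<noteq> 0"
      \<comment> \<open>With F = 0 the form is affine in t, and this t gives it the value
        -1.\<close>
      then show False using q[of "- (G + 1) / (2 * P)"] True F0 G0 by (simp add: field_simps)
    qed
    then show ?thesis using True by simp
  next
    case False
    then have F: "F > 0" using F0 by simp
    have "(- P / F)\<^sup>2 * F + 2 * (- P / F) * P + G = G - P\<^sup>2 / F"
      using F by (simp add: power2_eq_square field_simps)
    then have "P\<^sup>2 / F \<le> G" using q[of "- P / F"] by simp
    then show ?thesis using F by (simp add: divide_le_eq mult.commute)
  qed
  then have "sqrt (P\<^sup>2) \<le> sqrt (F * G)" by (rule real_sqrt_le_mono)
  then show ?thesis by (simp add: real_sqrt_mult F_def G_def P_def)
qed

text \<open>Turns the extended-real limits of \<open>has_wiener_integral\<close> into statements on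
  Bochner integrals. Some a_n lies at finite L^2 distance from f, and f^2 \<le> 2 a_n^2 + 2 (a_n -
  f)^2 carries square integrability over to f.\<close>

lemma L2_limit_square_integrable:
  fixes a :: "nat \<Rightarrow> 'a \<Rightarrow> real"
  assumes [measurable]: "\<And>n. a n \<in> borel_measurable M" "f \<in> borel_measurable M"
    and lim: "(\<lambda>n. \<integral>\<^sup>+ x. ennreal ((a n x - f x)\<^sup>2) \<partial>M) \<longlonglongrightarrow> 0"
    and a2: "\<And>n. integrable M (\<lambda>x. (a n x)\<^sup>2)"
  shows "integrable M (\<lambda>x. (f x)\<^sup>2)"
    and "\<And>n. integrable M (\<lambda>x. (a n x - f x)\<^sup>2)"
    and "(\<lambda>n. \<integral>x. (a n x - f x)\<^sup>2 \<partial>M) \<longlonglongrightarrow> 0"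
proof -
  have le: "(x - y)\<^sup>2 \<le> 2 * x\<^sup>2 + 2 * y\<^sup>2" for x y :: real
    using zero_le_power2[of "x + y"] by (simp add: power2_eq_square algebra_simps)
  have "eventually (\<lambda>n. (\<integral>\<^sup>+ x. ennreal ((a n x - f x)\<^sup>2) \<partial>M) < 1) sequentially"
    using lim by (rule order_tendstoD) simp
  then obtain n where "(\<integral>\<^sup>+ x. ennreal ((a n x - f x)\<^sup>2) \<partial>M) < 1"
    by (auto simp: eventually_sequentially)
  then have n: "integrable M (\<lambda>x. (a n x - f x)\<^sup>2)"
    by (intro integrableI_nonneg) (auto intro: less_trans)
  show f2: "integrable M (\<lambda>x. (f x)\<^sup>2)"
  proof (rule Bochner_Integration.integrable_bound)
    show "integrable M (\<lambda>x. 2 * (a n x)\<^sup>2 + 2 * (a n x - f x)\<^sup>2)"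
      using n a2 by simp
    have "(f x)\<^sup>2 \<le> 2 * (a n x)\<^sup>2 + 2 * (a n x - f x)\<^sup>2" for x
      using le[of "a n x" "a n x - f x"] by simp
    then show "AE x in M. norm ((f x)\<^sup>2) \<le> norm (2 * (a n x)\<^sup>2 + 2 * (a n x - f x)\<^sup>2)"
      by simp
  qed simp
  show d2: "integrable M (\<lambda>x. (a n x - f x)\<^sup>2)" for n
  proof (rule Bochner_Integration.integrable_bound)
    show "integrable M (\<lambda>x. 2 * (a n x)\<^sup>2 + 2 * (f x)\<^sup>2)"
      using f2 a2 by simp
    show "AE x in M. norm ((a n x - f x)\<^sup>2) \<le> norm (2 * (a n x)\<^sup>2 + 2 * (f x)\<^sup>2)"
      using le by simp
  qed simp
  have "(\<lambda>n. ennreal (\<integral>x. (a n x - f x)\<^sup>2 \<partial>M)) \<longlonglongrightarrow> ennreal 0"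
    using lim d2 by (simp add: nn_integral_eq_integral)
  then show "(\<lambda>n. \<integral>x. (a n x - f x)\<^sup>2 \<partial>M) \<longlonglongrightarrow> 0"
    by (subst (asm) tendsto_ennreal_iff) auto
qed

text \<open>Rests on a b - f g = (a - f) (b - g) + f (b - g) + (a - f) g, where Cauchy-Schwarz sends
  the integral of each summand to 0: continuity of the L^2 inner product.\<close>

lemma L2_limit_integral_product:
  fixes a b :: "nat \<Rightarrow> 'a \<Rightarrow> real"
  assumes [measurable]: "\<And>n. a n \<in> borel_measurable M" "f \<in> borel_measurable M"
      "\<And>n. b n \<in> borel_measurable M" "g \<in> borel_measurable M"
    and lim_a: "(\<lambda>n. \<integral>\<^sup>+ x. ennreal ((a n x - f x)\<^sup>2) \<partial>M) \<longlonglongrightarrow> 0"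
    and lim_b: "(\<lambda>n. \<integral>\<^sup>+ x. ennreal ((b n x - g x)\<^sup>2) \<partial>M) \<longlonglongrightarrow> 0"
    and a2: "\<And>n. integrable M (\<lambda>x. (a n x)\<^sup>2)"
    and b2: "\<And>n. integrable M (\<lambda>x. (b n x)\<^sup>2)"
  shows "integrable M (\<lambda>x. f x * g x)"
    and "(\<lambda>n. \<integral>x. a n x * b n x \<partial>M) \<longlonglongrightarrow> (\<integral>x. f x * g x \<partial>M)"
proof -
  note A = L2_limit_square_integrable[OF assms(1,2) lim_a a2]
  note B = L2_limit_square_integrable[OF assms(3,4) lim_b b2]
  have sqrtA: "(\<lambda>n. sqrt (\<integral>x. (a n x - f x)\<^sup>2 \<partial>M)) \<longlonglongrightarrow> 0"
    using tendsto_real_sqrt[OF A(3)] by simp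
  have sqrtB: "(\<lambda>n. sqrt (\<integral>x. (b n x - g x)\<^sup>2 \<partial>M)) \<longlonglongrightarrow> 0"
    using tendsto_real_sqrt[OF B(3)] by simp
  show fg: "integrable M (\<lambda>x. f x * g x)"
    using A B by (intro integrable_product_of_squares) auto
  let ?R = "\<lambda>n. sqrt (\<integral>x. (a n x - f x)\<^sup>2 \<partial>M) * sqrt (\<integral>x. (b n x - g x)\<^sup>2 \<partial>M)
    + sqrt (\<integral>x. (f x)\<^sup>2 \<partial>M) * sqrt (\<integral>x. (b n x - g x)\<^sup>2 \<partial>M)
    + sqrt (\<integral>x. (a n x - f x)\<^sup>2 \<partial>M) * sqrt (\<integral>x. (g x)\<^sup>2 \<partial>M)"
  have R: "?R \<longlonglongrightarrow> 0 * 0 + sqrt (\<integral>x. (f x)\<^sup>2 \<partial>M) * 0 + 0 * sqrt (\<integral>x. (g x)\<^sup>2 \<partial>M)"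
    by (intro tendsto_intros sqrtA sqrtB)
  have bound: "\<bar>(\<integral>x. a n x * b n x \<partial>M) - (\<integral>x. f x * g x \<partial>M)\<bar> \<le> ?R n" for n
  proof -
    have i1: "integrable M (\<lambda>x. (a n x - f x) * (b n x - g x))"
      using A B by (intro integrable_product_of_squares) auto
    have i2: "integrable M (\<lambda>x. f x * (b n x - g x))"
      using A B by (intro integrable_product_of_squares) auto
    have i3: "integrable M (\<lambda>x. (a n x - f x) * g x)"
      using A B by (intro integrable_product_of_squares) auto
    have "(\<lambda>x. a n x * b n x) = (\<lambda>x. (a n x - f x) * (b n x - g x) + f x * (b n x - g x)
        + (a n x - f x) * g x + f x * g x)"
      by (auto simp: algebra_simps)
    then have "(\<integral>x. a n x * b n x \<partial>M) - (\<integral>x. f x * g x \<partial>M) =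
        (\<integral>x. (a n x - f x) * (b n x - g x) \<partial>M) + (\<integral>x. f x * (b n x - g x) \<partial>M)
        + (\<integral>x. (a n x - f x) * g x \<partial>M)"
      using i1 i2 i3 fg by simp
    moreover have "\<bar>\<integral>x. (a n x - f x) * (b n x - g x) \<partial>M\<bar>
        \<le> sqrt (\<integral>x. (a n x - f x)\<^sup>2 \<partial>M) * sqrt (\<integral>x. (b n x - g x)\<^sup>2 \<partial>M)"
      using A B by (intro Cauchy_Schwarz_integral) auto
    moreover have "\<bar>\<integral>x. f x * (b n x - g x) \<partial>M\<bar>
        \<le> sqrt (\<integral>x. (f x)\<^sup>2 \<partial>M) * sqrt (\<integral>x. (b n x - g x)\<^sup>2 \<partial>M)"
      using A B by (intro Cauchy_Schwarz_integral) auto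
    moreover have "\<bar>\<integral>x. (a n x - f x) * g x \<partial>M\<bar>
        \<le> sqrt (\<integral>x. (a n x - f x)\<^sup>2 \<partial>M) * sqrt (\<integral>x. (g x)\<^sup>2 \<partial>M)"
      using A B by (intro Cauchy_Schwarz_integral) auto
    ultimately show ?thesis by linarith
  qed
  have "(\<lambda>n. (\<integral>x. a n x * b n x \<partial>M) - (\<integral>x. f x * g x \<partial>M)) \<longlonglongrightarrow> 0"
  proof (rule Lim_null_comparison)
    show "\<forall>\<^sub>F n in sequentially. norm ((\<integral>x. a n x * b n x \<partial>M) - (\<integral>x. f x * g x \<partial>M)) \<le> ?R n"
      using bound by (intro always_eventually) simp
    show "?R \<longlonglongrightarrow> 0" using R by simp
  qed
  then show "(\<lambda>n. \<integral>x. a n x * b n x \<partial>M) \<longlonglongrightarrow> (\<integral>x. f x * g x \<partial>M)"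
    by (simp add: LIM_zero_iff)
qed

section \<open>Isometry for simple integrands and its extension to mean-square limits\<close>

lemma simple_function_level_set:
  fixes s :: "'a \<Rightarrow> real"
  assumes s: "simple_function N s" "emeasure N {x\<in>space N. s x \<noteq> 0} < \<infinity>" and y: "y \<noteq> 0"
  shows "s -` {y} \<inter> space N \<in> sets N" and "emeasure N (s -` {y} \<inter> space N) < \<infinity>"
proof -
  show "s -` {y} \<inter> space N \<in> sets N"
    using s(1) by (rule simple_functionD)
  have [measurable]: "s \<in> borel_measurable N"
    using s(1) by (rule borel_measurable_simple_function)
  have "emeasure N (s -` {y} \<inter> space N) \<le> emeasure N {x\<in>space N. s x \<noteq> 0}"
    using y by (intro emeasure_mono) auto
  then show "emeasure N (s -` {y} \<inter> space N) < \<infinity>"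
    using s(2) by (rule le_less_trans)
qed

text \<open>Measurability is extracted from \<open>centered_gaussian\<close>, applied to a linear
  combination with one term.\<close>

lemma gaussian_random_measure_measurable:
  assumes B: "gaussian_random_measure M N B" and A: "A \<in> sets N" "emeasure N A < \<infinity>"
  shows "B A \<in> borel_measurable M"
proof -
  have lin: "\<forall>J a. finite J \<longrightarrow> J \<subseteq> {A \<in> sets N. emeasure N A < \<infinity>} \<longrightarrow>
      centered_gaussian M (\<lambda>\<omega>. \<Sum>A\<in>J. a A * B A \<omega>)"
    using B unfolding gaussian_random_measure_def by (elim conjE)
  have "centered_gaussian M (\<lambda>\<omega>. \<Sum>A\<in>{A}. 1 * B A \<omega>)"
    using lin[rule_format, of "{A}" "\<lambda>_. 1"] A by simp
  then show ?thesis by (simp add: centered_gaussian_def)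
qed

text \<open>Expanding both factors over their nonzero values y and z reduces everything to
  E[B(S_y) B(R_z)] = N(S_y \<inter> R_z); both sides equal the double sum of y z N(S_y \<inter>
  R_z).\<close>

lemma simple_wiener_integral_isometry:
  assumes B: "gaussian_random_measure M N B"
    and s: "simple_function N s" "emeasure N {x\<in>space N. s x \<noteq> 0} < \<infinity>"
    and r: "simple_function N r" "emeasure N {x\<in>space N. r x \<noteq> 0} < \<infinity>"
  shows "integrable M (\<lambda>\<omega>. simple_wiener_integral N B s \<omega> * simple_wiener_integral N B r \<omega>)"
    and "integrable N (\<lambda>x. s x * r x)"
    and "(\<integral>\<omega>. simple_wiener_integral N B s \<omega> * simple_wiener_integral N B r \<omega> \<partial>M)
         = (\<integral>x. s x * r x \<partial>N)"
proof -
  define S where "S y = s -` {y} \<inter> space N" for y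
  define R where "R y = r -` {y} \<inter> space N" for y
  let ?I = "s ` space N - {0}" and ?J = "r ` space N - {0}"
  have fin: "finite ?I" "finite ?J"
    using simple_functionD(1)[OF s(1)] simple_functionD(1)[OF r(1)] by auto
  have cov: "integrable M (\<lambda>\<omega>. B (S y) \<omega> * B (R z) \<omega>)"
      "(\<integral>\<omega>. B (S y) \<omega> * B (R z) \<omega> \<partial>M) = measure N (S y \<inter> R z)"
    if "y \<in> ?I" "z \<in> ?J" for y z
    using B simple_function_level_set[OF s, of y] simple_function_level_set[OF r, of z] that
    by (auto simp: gaussian_random_measure_def S_def R_def)
  have W: "simple_wiener_integral N B s \<omega> * simple_wiener_integral N B r \<omega>
     = (\<Sum>y\<in>?I. \<Sum>z\<in>?J. y * z * (B (S y) \<omega> * B (R z) \<omega>))" for \<omega>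
    unfolding simple_wiener_integral_def sum_product S_def R_def
    by (intro sum.cong refl) (simp add: mult_ac)
  \<comment> \<open>The value 0 is left out of the canonical sum: it contributes nothing, and its
    level set may have infinite measure.\<close>
  have rep: "A x = (\<Sum>y\<in>A ` space N - {0}. y * indicator (A -` {y} \<inter> space N) x)"
    if "x \<in> space N" "finite (A ` space N - {0})" for A :: "_ \<Rightarrow> real" and x
  proof -
    have "(\<Sum>y\<in>A ` space N - {0}. y * indicator (A -` {y} \<inter> space N) x)
      = (\<Sum>y\<in>A ` space N - {0}. if y = A x then y else 0)"
      using that by (intro sum.cong) (auto simp: indicator_def)
    also have "\<dots> = A x"
      using that by (subst sum.delta) auto
    finally show ?thesis by simp
  qed
  have P: "s x * r x = (\<Sum>y\<in>?I. \<Sum>z\<in>?J. y * z * indicator (S y \<inter> R z) x)"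
    if "x \<in> space N" for x
    unfolding rep[OF that fin(1)] rep[OF that fin(2)] sum_product S_def R_def
      indicator_inter_arith
    by (intro sum.cong refl) (simp add: mult_ac)
  have SR: "S y \<inter> R z \<in> sets N \<and> emeasure N (S y \<inter> R z) < \<infinity>"
    if "y \<in> ?I" "z \<in> ?J" for y z
  proof -
    have "emeasure N (S y \<inter> R z) \<le> emeasure N (S y)"
      using simple_function_level_set[OF s, of y] that by (intro emeasure_mono) (auto simp: S_def)
    then show ?thesis
      using simple_function_level_set[OF s, of y] simple_function_level_set[OF r, of z] that
      by (auto simp: S_def R_def intro: le_less_trans)
  qed
  have ind: "integrable N (\<lambda>x. indicator (S y \<inter> R z) x :: real)"
    if "y \<in> ?I" "z \<in> ?J" for y z
    using SR[OF that] by (simp add: integrable_indicator_iff)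
  show "integrable M (\<lambda>\<omega>. simple_wiener_integral N B s \<omega> * simple_wiener_integral N B r \<omega>)"
    unfolding W using cov(1)
    by (intro Bochner_Integration.integrable_sum integrable_mult_right) auto
  have "integrable N (\<lambda>x. \<Sum>y\<in>?I. \<Sum>z\<in>?J. y * z * indicator (S y \<inter> R z) x)"
    using ind by (intro Bochner_Integration.integrable_sum integrable_mult_right) auto
  then show "integrable N (\<lambda>x. s x * r x)"
    by (subst Bochner_Integration.integrable_cong[OF refl P])
  have "(\<integral>\<omega>. simple_wiener_integral N B s \<omega> * simple_wiener_integral N B r \<omega> \<partial>M)
     = (\<Sum>y\<in>?I. \<Sum>z\<in>?J. y * z * measure N (S y \<inter> R z))"
  proof -
    have "(\<integral>\<omega>. (\<Sum>y\<in>?I. \<Sum>z\<in>?J. y * z * (B (S y) \<omega> * B (R z) \<omega>)) \<partial>M)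
      = (\<Sum>y\<in>?I. (\<integral>\<omega>. (\<Sum>z\<in>?J. y * z * (B (S y) \<omega> * B (R z) \<omega>)) \<partial>M))"
      using cov(1) by (intro Bochner_Integration.integral_sum Bochner_Integration.integrable_sum
        integrable_mult_right) auto
    also have "\<dots> = (\<Sum>y\<in>?I. \<Sum>z\<in>?J. (\<integral>\<omega>. y * z * (B (S y) \<omega> * B (R z) \<omega>) \<partial>M))"
      using cov(1)
      by (intro sum.cong refl Bochner_Integration.integral_sum integrable_mult_right) auto
    also have "\<dots> = (\<Sum>y\<in>?I. \<Sum>z\<in>?J. y * z * measure N (S y \<inter> R z))"
      using cov(2) by (intro sum.cong refl) simp
    finally show ?thesis unfolding W .
  qed
  also have "\<dots> = (\<integral>x. (\<Sum>y\<in>?I. \<Sum>z\<in>?J. y * z * indicator (S y \<inter> R z) x) \<partial>N)"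
  proof -
    have "(\<integral>x. (\<Sum>y\<in>?I. \<Sum>z\<in>?J. y * z * indicator (S y \<inter> R z) x) \<partial>N)
      = (\<Sum>y\<in>?I. (\<integral>x. (\<Sum>z\<in>?J. y * z * indicator (S y \<inter> R z) x) \<partial>N))"
      using ind by (intro Bochner_Integration.integral_sum Bochner_Integration.integrable_sum
        integrable_mult_right) auto
    also have "\<dots> = (\<Sum>y\<in>?I. \<Sum>z\<in>?J. (\<integral>x. y * z * indicator (S y \<inter> R z) x \<partial>N))"
      using ind by (intro sum.cong refl Bochner_Integration.integral_sum integrable_mult_right) auto
    also have "\<dots> = (\<Sum>y\<in>?I. \<Sum>z\<in>?J. y * z * measure N (S y \<inter> R z))"
      using SR sets.sets_into_space by (intro sum.cong refl) (auto simp: Int_absorb2)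
    finally show ?thesis by simp
  qed
  also have "\<dots> = (\<integral>x. s x * r x \<partial>N)"
    by (rule Bochner_Integration.integral_cong[OF refl P[symmetric]])
  finally show "(\<integral>\<omega>. simple_wiener_integral N B s \<omega> * simple_wiener_integral N B r \<omega> \<partial>M)
         = (\<integral>x. s x * r x \<partial>N)" .
qed

lemma simple_wiener_integral_measurable:
  assumes B: "gaussian_random_measure M N B"
    and s: "simple_function N s" "emeasure N {x\<in>space N. s x \<noteq> 0} < \<infinity>"
  shows "simple_wiener_integral N B s \<in> borel_measurable M"
proof -
  have "B (s -` {y} \<inter> space N) \<in> borel_measurable M" if "y \<noteq> 0" for y
    using B simple_function_level_set[OF s that] by (rule gaussian_random_measure_measurable)
  then show ?thesis
    unfolding simple_wiener_integral_def[abs_def]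
    by (intro borel_measurable_sum borel_measurable_times borel_measurable_const) simp_all
qed

text \<open>Both sides of the simple isometry converge, by continuity of the inner product, and
  limits are unique. Integrability of \<open>f x * g x\<close> is a conclusion here, so the square
  integrability of the kernels follows from the existence of the integrals instead of a computation
  with the parameters.\<close>

lemma wiener_integral_isometry:
  assumes B: "gaussian_random_measure M N B"
    and I: "has_wiener_integral M N B f I" and J: "has_wiener_integral M N B g J"
  shows "integrable M (\<lambda>\<omega>. I \<omega> * J \<omega>)" and "integrable N (\<lambda>x. f x * g x)"
    and "(\<integral>\<omega>. I \<omega> * J \<omega> \<partial>M) = (\<integral>x. f x * g x \<partial>N)"
proof -
  from I obtain s where s: "f \<in> borel_measurable N" "I \<in> borel_measurable M"
    "\<And>n. simple_function N (s n)" "\<And>n. emeasure N {x\<in>space N. s n x \<noteq> 0} < \<infinity>"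
    "(\<lambda>n. \<integral>\<^sup>+ x. ennreal ((s n x - f x)\<^sup>2) \<partial>N) \<longlonglongrightarrow> 0"
    "(\<lambda>n. \<integral>\<^sup>+ \<omega>. ennreal ((simple_wiener_integral N B (s n) \<omega> - I \<omega>)\<^sup>2) \<partial>M) \<longlonglongrightarrow> 0"
    unfolding has_wiener_integral_def by blast
  from J obtain r where r: "g \<in> borel_measurable N" "J \<in> borel_measurable M"
    "\<And>n. simple_function N (r n)" "\<And>n. emeasure N {x\<in>space N. r n x \<noteq> 0} < \<infinity>"
    "(\<lambda>n. \<integral>\<^sup>+ x. ennreal ((r n x - g x)\<^sup>2) \<partial>N) \<longlonglongrightarrow> 0"
    "(\<lambda>n. \<integral>\<^sup>+ \<omega>. ennreal ((simple_wiener_integral N B (r n) \<omega> - J \<omega>)\<^sup>2) \<partial>M) \<longlonglongrightarrow> 0"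
    unfolding has_wiener_integral_def by blast
  note iso = simple_wiener_integral_isometry[OF B]
  have sq: "integrable N (\<lambda>x. (q x)\<^sup>2)"
      "integrable M (\<lambda>\<omega>. (simple_wiener_integral N B q \<omega>)\<^sup>2)"
    if "simple_function N q" "emeasure N {x\<in>space N. q x \<noteq> 0} < \<infinity>" for q
    using iso(1,2)[OF that that] by (simp_all add: power2_eq_square)
  note N_lim = L2_limit_integral_product[OF borel_measurable_simple_function[OF s(3)] s(1)
      borel_measurable_simple_function[OF r(3)] r(1) s(5) r(5)
      sq(1)[OF s(3,4)] sq(1)[OF r(3,4)]]
  note M_lim = L2_limit_integral_product[OF simple_wiener_integral_measurable[OF B s(3,4)] s(2)
      simple_wiener_integral_measurable[OF B r(3,4)] r(2) s(6) r(6)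
      sq(2)[OF s(3,4)] sq(2)[OF r(3,4)]]
  show "integrable M (\<lambda>\<omega>. I \<omega> * J \<omega>)" by (rule M_lim)
  show "integrable N (\<lambda>x. f x * g x)" by (rule N_lim)
  show "(\<integral>\<omega>. I \<omega> * J \<omega> \<partial>M) = (\<integral>x. f x * g x \<partial>N)"
    using M_lim(2) N_lim(2) unfolding iso(3)[OF s(3,4) r(3,4)] by (rule LIMSEQ_unique)
qed

section \<open>The kernel and its covariance\<close>

lemma powr_add_le:
  fixes x y a :: real
  assumes "0 < x" "0 < y" "a \<le> 1"
  shows "(x + y) powr a \<le> x powr a + y powr a" and "(x + y) powr a \<le> x * y powr (a - 1) + y powr a"
proof -
  have split: "z powr a = z * z powr (a - 1)" if "z > 0" for z :: real
    using that by (simp add: powr_diff)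
  \<comment> \<open>Each summand carries the exponent a - 1 \<le> 0, for which the power is antitone
    in its base.\<close>
  have "(x + y) powr a = x * (x + y) powr (a - 1) + y * (x + y) powr (a - 1)"
    using split[of "x + y"] assms by (simp add: algebra_simps)
  moreover have "(x + y) powr (a - 1) \<le> x powr (a - 1)" "(x + y) powr (a - 1) \<le> y powr (a - 1)"
    using assms by (auto intro!: powr_mono2')
  then have "x * (x + y) powr (a - 1) \<le> x * x powr (a - 1)"
    "x * (x + y) powr (a - 1) \<le> x * y powr (a - 1)"
    "y * (x + y) powr (a - 1) \<le> y * y powr (a - 1)"
    using assms by (auto intro!: mult_left_mono)
  ultimately show "(x + y) powr a \<le> x powr a + y powr a"
    "(x + y) powr a \<le> x * y powr (a - 1) + y powr a"
    unfolding split[OF assms(1)] split[OF assms(2)] by linarith+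
qed

text \<open>Mean value theorem: for a \<le> 1 the derivative a z^(a-1) is smallest at the right end
  x + y.\<close>

lemma powr_increment_ge:
  fixes x y a :: real
  assumes "0 < x" "0 < y" "0 \<le> a" "a \<le> 1"
  shows "a * x * (x + y) powr (a - 1) \<le> (x + y) powr a - y powr a"
proof -
  have "\<exists>z. y < z \<and> z < x + y \<and> (x + y) powr a - y powr a = (x + y - y) * (a * z powr (a - 1))"
    using assms by (intro MVT2) (auto intro!: derivative_eq_intros simp: powr_diff)
  then obtain z where z: "y < z" "z < x + y" "(x + y) powr a - y powr a = x * (a * z powr (a - 1))"
    by auto
  have "(x + y) powr (a - 1) \<le> z powr (a - 1)"
    using z assms by (intro powr_mono2') auto
  then have "a * x * (x + y) powr (a - 1) \<le> a * x * z powr (a - 1)"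
    using assms by (intro mult_left_mono) auto
  then show ?thesis using z by (simp add: mult_ac)
qed

text \<open>Interpolates between the bounds x^a (d = 0) and x y^(a-1) (d = 1 - a) given by
  \<open>powr_add_le\<close>; the first is the better one for y \<le> x, the second for y \<ge> x.
  The free exponent d trades growth in x for decay in y.\<close>

lemma powr_increment_le_interpolated:
  fixes x y a d :: real
  assumes "0 < x" "0 < y" "a \<le> 1" "0 \<le> d" "d \<le> 1 - a"
  shows "(x + y) powr a - y powr a \<le> x powr (a + d) * y powr (- d)"
proof (cases "y \<le> x")
  case True
  have "(x + y) powr a - y powr a \<le> x powr (a + d) * x powr (- d)"
    using powr_add_le(1)[of x y a] assms by (simp flip: powr_add)
  also have "\<dots> \<le> x powr (a + d) * y powr (- d)"
    using assms True by (intro mult_left_mono powr_mono2') auto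
  finally show ?thesis .
next
  case False
  have "(x + y) powr a - y powr a \<le> x * y powr (a - 1)"
    using powr_add_le(2)[of x y a] assms by simp
  also have "\<dots> = x powr (a + d) * (x powr (1 - a - d) * y powr (a - 1))"
    using assms by (simp flip: powr_add mult.assoc)
  also have "\<dots> \<le> x powr (a + d) * (y powr (1 - a - d) * y powr (a - 1))"
    using assms False by (intro mult_left_mono mult_right_mono powr_mono2) auto
  also have "\<dots> = x powr (a + d) * y powr (- d)"
    by (simp flip: powr_add)
  finally show ?thesis .
qed

text \<open>The ratio (1+y)^a / y^a equals (y/(1+y))^(-a), which is at least y/(1+y) because the
  base is below 1 and -a \<le> 1. What remains is y^a / (1+y).\<close>

lemma powr_neg_increment_le:
  fixes y a :: real
  assumes "0 < y" "- 1 \<le> a" "a \<le> 0"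
  shows "y powr a - (1 + y) powr a \<le> y powr (a - 1)"
proof -
  have "y / (1 + y) = (y / (1 + y)) powr 1"
    using assms by simp
  also have "\<dots> \<le> (y / (1 + y)) powr (- a)"
    using assms by (intro powr_mono') auto
  finally have "y powr a * (y / (1 + y)) \<le> y powr a * (y / (1 + y)) powr (- a)"
    by (intro mult_left_mono) auto
  also have "\<dots> = (1 + y) powr a"
    using assms by (simp add: powr_divide powr_minus field_simps)
  finally have "y powr a - (1 + y) powr a \<le> y powr a * (1 - y / (1 + y))"
    by (simp add: algebra_simps)
  also have "\<dots> = y powr a / (1 + y)"
    using assms by (simp add: field_simps)
  also have "\<dots> \<le> y powr a / y"
    using assms by (intro divide_left_mono) auto
  also have "\<dots> = y powr (a - 1)"
    using assms by (simp add: powr_diff)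
  finally show ?thesis .
qed

section \<open>Lower bounds for integrals and integrable majorants\<close>

lemma integral_ge_on_subset:
  fixes f :: "'a \<Rightarrow> real"
  assumes f: "integrable M f" "\<And>x. 0 \<le> f x" and S: "S \<in> sets M" "emeasure M S < \<infinity>"
    and c: "\<And>x. x \<in> S \<Longrightarrow> c \<le> f x"
  shows "c * measure M S \<le> (\<integral>x. f x \<partial>M)"
proof -
  have "c * measure M S = (\<integral>x. c * indicator S x \<partial>M)"
    using sets.sets_into_space[OF S(1)] by (simp add: Int_absorb2 del: indicator_simps)
  also have "\<dots> \<le> (\<integral>x. f x \<partial>M)"
  proof (rule integral_mono)
    show "integrable M (\<lambda>x. c * indicator S x)"
      using S by (intro integrable_mult_right integrable_real_indicator)
  qed (use f c in \<open>auto simp: indicator_def\<close>)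
  finally show ?thesis .
qed

text \<open>The majorants of the kernel products have this shape: one exponent for the singularity
  at u = 0, one for the decay at both infinities.\<close>

lemma integrable_two_power_tail:
  fixes a b :: real
  assumes "- 1 < a" "b < - 1"
  shows "integrable lborel (\<lambda>u::real. if \<bar>u\<bar> \<le> 1 then \<bar>u\<bar> powr a else \<bar>u\<bar> powr b)"
proof -
  have 1: "set_integrable lborel {0..1} (\<lambda>u::real. u powr a)"
  proof -
    \<comment> \<open>\<open>absolutely_integrable_on\<close> refers to the completed measure; Borel
      measurability brings the statement back to \<open>lborel\<close>.\<close>
    have "(\<lambda>u. u powr a) absolutely_integrable_on {0..1::real}"
      using assms by (intro nonnegative_absolutely_integrable_1 integrable_on_powr_from_0) auto
    then show ?thesis
      unfolding set_integrable_def by (subst (asm) integrable_completion) auto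
  qed
  have 2: "set_integrable lborel {1..} (\<lambda>u::real. u powr b)"
  proof -
    have "(\<lambda>u. u powr b) absolutely_integrable_on {1::real..}"
      using assms has_integral_powr_to_inf[of b 1]
      by (intro nonnegative_absolutely_integrable_1) (auto simp: integrable_on_def intro!: exI)
    then show ?thesis
      unfolding set_integrable_def by (subst (asm) integrable_completion) auto
  qed
  \<comment> \<open>k covers the positive half-line and its reflection the negative one. The points
    \<bar>u\<bar> = 1 are counted twice, hence domination below and not equality.\<close>
  define k :: "real \<Rightarrow> real"
    where "k u = indicator {0..1} u *\<^sub>R (u powr a) + indicator {1..} u *\<^sub>R (u powr b)" for u
  have k: "integrable lborel k"
    using 1 2 unfolding k_def set_integrable_def by (rule Bochner_Integration.integrable_add)
  then have k': "integrable lborel (\<lambda>u. k (- u))"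
    using lborel_integrable_real_affine[OF k, of "-1" 0] by simp
  show ?thesis
  proof (rule Bochner_Integration.integrable_bound)
    show "integrable lborel (\<lambda>u. k u + k (- u))"
      using k k' by (rule Bochner_Integration.integrable_add)
    show "AE u in lborel. norm (if \<bar>u\<bar> \<le> 1 then \<bar>u\<bar> powr a else \<bar>u\<bar> powr b) \<le> norm (k u + k (- u))"
      by (rule AE_I2) (auto simp: k_def indicator_def abs_if)
  qed measurable
qed

section \<open>The kernel on the two half-lines, its sign and its scaling\<close>

lemma gfbm_kernel_0: "gfbm_kernel \<alpha> \<gamma> t 0 = 0"
  by (simp add: gfbm_kernel_def)

lemma gfbm_kernel_pos:
  "0 < u \<Longrightarrow> gfbm_kernel \<alpha> \<gamma> t u = (if u < t then (t - u) powr \<alpha> * u powr (- \<gamma> / 2) else 0)"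
  by (auto simp: gfbm_kernel_def pos_part_powr_def max_def)

lemma gfbm_kernel_neg:
  "0 < v \<Longrightarrow> 0 \<le> t \<Longrightarrow>
    gfbm_kernel \<alpha> \<gamma> t (- v) = ((t + v) powr \<alpha> - v powr \<alpha>) * v powr (- \<gamma> / 2)"
  by (auto simp: gfbm_kernel_def pos_part_powr_def max_def)

lemma gfbm_kernel_measurable [measurable]: "gfbm_kernel \<alpha> \<gamma> t \<in> borel_measurable borel"
  unfolding gfbm_kernel_def[abs_def] pos_part_powr_def by measurable

lemma gfbm_kernel_product_pos:
  assumes "0 < u"
  shows "gfbm_kernel \<alpha> \<gamma> s u * gfbm_kernel \<alpha> \<gamma> t u =
    (if u < s \<and> u < t then (s - u) powr \<alpha> * (t - u) powr \<alpha> * u powr (- \<gamma>) else 0)"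
proof -
  have "u powr (- \<gamma> / 2) * u powr (- \<gamma> / 2) = u powr (- \<gamma>)"
    by (simp flip: powr_add)
  then show ?thesis
    using assms by (simp add: gfbm_kernel_pos mult_ac)
qed

lemma gfbm_kernel_product_neg:
  assumes "0 < v" "0 \<le> s" "0 \<le> t"
  shows "gfbm_kernel \<alpha> \<gamma> s (- v) * gfbm_kernel \<alpha> \<gamma> t (- v) =
    ((s + v) powr \<alpha> - v powr \<alpha>) * ((t + v) powr \<alpha> - v powr \<alpha>) * v powr (- \<gamma>)"
proof -
  have "v powr (- \<gamma> / 2) * v powr (- \<gamma> / 2) = v powr (- \<gamma>)"
    by (simp flip: powr_add)
  then show ?thesis
    using assms by (simp add: gfbm_kernel_neg mult_ac)
qed

text \<open>For u < 0 both increments of the power have the same sign, whichever sign \<alpha> has;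
  for u > 0 all factors are nonnegative.\<close>

lemma gfbm_kernel_product_nonneg:
  assumes "0 \<le> s" "0 \<le> t"
  shows "0 \<le> gfbm_kernel \<alpha> \<gamma> s u * gfbm_kernel \<alpha> \<gamma> t u"
proof (cases u "0::real" rule: linorder_cases)
  case less
  define v where "v = - u"
  then have v: "0 < v" "u = - v" using less by auto
  have "0 \<le> ((s + v) powr \<alpha> - v powr \<alpha>) * ((t + v) powr \<alpha> - v powr \<alpha>)"
  proof (cases "0 \<le> \<alpha>")
    case True
    then show ?thesis
      using assms v by (intro mult_nonneg_nonneg) (auto intro!: powr_mono2)
  next
    case False
    then show ?thesis
      using assms v by (intro mult_nonpos_nonpos) (auto intro!: powr_mono2')
  qed
  then show ?thesis
    using assms v by (simp add: gfbm_kernel_product_neg)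
next
  case equal
  then show ?thesis by (simp add: gfbm_kernel_0)
next
  case greater
  then show ?thesis by (simp add: gfbm_kernel_product_pos)
qed

text \<open>The difference of powers contributes l^\<alpha>, the weight contributes
  l^(-\<gamma>/2).\<close>

lemma gfbm_kernel_scale:
  assumes "0 < l"
  shows "gfbm_kernel \<alpha> \<gamma> (l * t) (l * u) = l powr (\<alpha> - \<gamma> / 2) * gfbm_kernel \<alpha> \<gamma> t u"
proof -
  have p: "pos_part_powr (l * x) \<alpha> = l powr \<alpha> * pos_part_powr x \<alpha>" for x
    using assms by (auto simp: pos_part_powr_def max_def powr_mult mult_le_0_iff not_le
        zero_less_mult_iff)
  have "gfbm_kernel \<alpha> \<gamma> (l * t) (l * u) =
     (pos_part_powr (l * (t - u)) \<alpha> - pos_part_powr (l * (- u)) \<alpha>) * (l * \<bar>u\<bar>) powr (- \<gamma> / 2)"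
    using assms by (simp add: gfbm_kernel_def abs_mult algebra_simps)
  also have "\<dots> = (l powr \<alpha> * l powr (- \<gamma> / 2)) * gfbm_kernel \<alpha> \<gamma> t u"
    unfolding p using assms by (simp add: gfbm_kernel_def powr_mult algebra_simps)
  also have "l powr \<alpha> * l powr (- \<gamma> / 2) = l powr (\<alpha> - \<gamma> / 2)"
    by (simp flip: powr_add)
  finally show ?thesis .
qed

section \<open>The unnormalised covariance K: homogeneity, and positivity of the constant c\<close>

definition gfbm_cov :: "real \<Rightarrow> real \<Rightarrow> real \<Rightarrow> real \<Rightarrow> real" where
  "gfbm_cov \<alpha> \<gamma> s t = (\<integral>u. gfbm_kernel \<alpha> \<gamma> s u * gfbm_kernel \<alpha> \<gamma> t u \<partial>lborel)"

text \<open>The substitution of l u for u gives one factor l and each kernel a factor l^(\<alpha> -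
  \<gamma>/2), together l^(2H).\<close>

lemma gfbm_cov_scale:
  assumes "0 < l"
  shows "gfbm_cov \<alpha> \<gamma> (l * s) (l * t) = l powr (2 * (\<alpha> - \<gamma> / 2 + 1 / 2)) * gfbm_cov \<alpha> \<gamma> s t"
proof -
  have "gfbm_cov \<alpha> \<gamma> (l * s) (l * t) =
     l * (\<integral>u. gfbm_kernel \<alpha> \<gamma> (l * s) (l * u) * gfbm_kernel \<alpha> \<gamma> (l * t) (l * u) \<partial>lborel)"
    unfolding gfbm_cov_def using assms by (subst lborel_integral_real_affine[of l _ 0]) auto
  also have "(\<lambda>u. gfbm_kernel \<alpha> \<gamma> (l * s) (l * u) * gfbm_kernel \<alpha> \<gamma> (l * t) (l * u)) =
      (\<lambda>u. (l powr (\<alpha> - \<gamma> / 2) * l powr (\<alpha> - \<gamma> / 2)) *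
        (gfbm_kernel \<alpha> \<gamma> s u * gfbm_kernel \<alpha> \<gamma> t u))"
    unfolding gfbm_kernel_scale[OF assms] by (simp add: mult_ac)
  also have "l * (\<integral>u. (l powr (\<alpha> - \<gamma> / 2) * l powr (\<alpha> - \<gamma> / 2)) *
      (gfbm_kernel \<alpha> \<gamma> s u * gfbm_kernel \<alpha> \<gamma> t u) \<partial>lborel) = (l powr 1 * l powr (\<alpha> - \<gamma> / 2) * l powr (\<alpha> - \<gamma> / 2)) * gfbm_cov \<alpha> \<gamma> s t"
    unfolding gfbm_cov_def integral_mult_right_zero using assms by (simp add: mult.assoc)
  also have "l powr 1 * l powr (\<alpha> - \<gamma> / 2) * l powr (\<alpha> - \<gamma> / 2) = l powr (2 * (\<alpha> - \<gamma> / 2 + 1 / 2))"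
    unfolding powr_add[symmetric] by (simp add: algebra_simps)
  finally show ?thesis .
qed

text \<open>The base of the outer power has to be positive, since \<open>0 powr (- 1 / 2)\<close> is
  0. The first integrand is the squared kernel for t = 1 on (0,1), so \<open>int\<close> makes it a
  genuine integral and not the default value 0.\<close>

lemma gfbm_const_pos:
  assumes "0 \<le> \<gamma>" "\<gamma> < 1" "\<alpha> < 1 / 2 + \<gamma> / 2"
    and int: "integrable lborel (\<lambda>u. gfbm_kernel \<alpha> \<gamma> 1 u * gfbm_kernel \<alpha> \<gamma> 1 u)"
  shows "0 < gfbm_const \<alpha> \<gamma>"
proof -
  let ?f = "\<lambda>v. indicator {0<..<1} v *\<^sub>R ((1 - v) powr (2 * \<alpha>) * v powr (- \<gamma>)) :: real"
  have eq: "?f v = gfbm_kernel \<alpha> \<gamma> 1 v * gfbm_kernel \<alpha> \<gamma> 1 v" if "0 < v" for v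
    using that by (simp add: gfbm_kernel_product_pos flip: powr_add)
  have "integrable lborel ?f"
  proof (rule Bochner_Integration.integrable_bound[OF int])
    show "AE v in lborel. norm (?f v) \<le> norm (gfbm_kernel \<alpha> \<gamma> 1 v * gfbm_kernel \<alpha> \<gamma> 1 v)"
    proof (rule AE_I2)
      fix v :: real
      show "norm (?f v) \<le> norm (gfbm_kernel \<alpha> \<gamma> 1 v * gfbm_kernel \<alpha> \<gamma> 1 v)"
      proof (cases "0 < v")
        case True
        then show ?thesis by (simp only: eq order.refl)
      qed (auto simp: indicator_def)
    qed
  qed measurable
  \<comment> \<open>On [1/4, 1/2], 1 - v \<ge> 1/2 and 2 \<alpha> < 1 + \<gamma> < 2 give
    (1-v)^(2\<alpha>) \<ge> 1/4, and v^(-\<gamma>) \<ge> 1.\<close>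
  then have "1 / 4 * measure lborel {1/4..1/2::real} \<le> (\<integral>v. ?f v \<partial>lborel)"
  proof (rule integral_ge_on_subset)
    fix v :: real assume v: "v \<in> {1/4..1/2}"
    have "(1/2)\<^sup>2 \<le> (1 - v)\<^sup>2"
      using v by (intro power_mono) auto
    also have "\<dots> = (1 - v) powr 2"
      using v by simp
    also have "\<dots> \<le> (1 - v) powr (2 * \<alpha>)"
      using v assms by (intro powr_mono') auto
    finally have "1 / 4 \<le> (1 - v) powr (2 * \<alpha>)" by (simp add: power2_eq_square)
    moreover have "v powr 0 \<le> v powr (- \<gamma>)"
      using v assms by (intro powr_mono') auto
    ultimately have "1 / 4 * 1 \<le> (1 - v) powr (2 * \<alpha>) * v powr (- \<gamma>)"
      using v by (intro mult_mono) auto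
    then show "1 / 4 \<le> ?f v" using v by simp
  qed auto
  then have "0 < (LINT v:{0<..<1}|lborel. (1 - v) powr (2 * \<alpha>) * v powr (- \<gamma>))"
    by (simp add: set_lebesgue_integral_def)
  \<comment> \<open>Nonnegativity is enough for the sum, and it covers the default value 0 as
    well.\<close>
  moreover have "0 \<le> (LINT v:{0<..}|lborel. ((1 + v) powr \<alpha> - v powr \<alpha>)\<^sup>2 * v powr (- \<gamma>))"
    unfolding set_lebesgue_integral_def by (intro Bochner_Integration.integral_nonneg) auto
  ultimately show ?thesis by (simp add: gfbm_const_def)
qed

section \<open>Upper and lower bounds for K(T,1) with T \<ge> 1\<close>

lemma gfbm_cov_upper_pos:
  assumes \<gamma>: "0 \<le> \<gamma>" "\<gamma> < 1" and \<alpha>: "0 < \<alpha>" "\<alpha> \<le> 1"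
    and d: "0 \<le> d" "d \<le> 1 - \<alpha>" "\<alpha> - \<gamma> < d"
  obtains C where "\<And>T. 1 \<le> T \<Longrightarrow> gfbm_cov \<alpha> \<gamma> T 1 \<le> C * T powr (\<alpha> + d)"
proof -
  \<comment> \<open>Majorant of the integrand after division by T^(\<alpha>+d). For v = -u in (0,1]
    the increments are at most T^\<alpha> and 1, which leaves the weight; for v > 1 they are at most
    T^(\<alpha>+d) v^(-d) and v^(\<alpha>-1). The tail exponent is below -1 exactly when \<alpha> -
    \<gamma> < d.\<close>
  define h where "h u = (if \<bar>u\<bar> \<le> 1 then \<bar>u\<bar> powr (- \<gamma>) else \<bar>u\<bar> powr (\<alpha> - 1 - \<gamma> - d))"
    for u :: real
  have h: "integrable lborel h"
    unfolding h_def using \<gamma> d by (intro integrable_two_power_tail) auto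
  have h0: "0 \<le> h u" for u by (simp add: h_def)
  have "gfbm_cov \<alpha> \<gamma> T 1 \<le> (\<integral>u. h u \<partial>lborel) * T powr (\<alpha> + d)" if T: "1 \<le> T" for T
  proof -
    have mono: "T powr \<alpha> \<le> T powr (\<alpha> + d)"
      using T d by (intro powr_mono) auto
    have "gfbm_kernel \<alpha> \<gamma> T u * gfbm_kernel \<alpha> \<gamma> 1 u \<le> T powr (\<alpha> + d) * h u" for u
    proof (cases u "0::real" rule: linorder_cases)
      case less
      define v where "v = - u"
      then have v: "0 < v" "u = - v" using less by auto
      have inc: "0 \<le> (T + v) powr \<alpha> - v powr \<alpha>" "0 \<le> (1 + v) powr \<alpha> - v powr \<alpha>"
        using v T \<alpha> by (auto intro!: powr_mono2)
      have "((T + v) powr \<alpha> - v powr \<alpha>) * ((1 + v) powr \<alpha> - v powr \<alpha>) * v powr (- \<gamma>)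
          \<le> T powr (\<alpha> + d) * h u"
      proof (cases "v \<le> 1")
        case True
        have "(T + v) powr \<alpha> - v powr \<alpha> \<le> T powr (\<alpha> + d)" "(1 + v) powr \<alpha> - v powr \<alpha> \<le> 1"
          using powr_add_le(1)[of T v \<alpha>] powr_add_le(1)[of 1 v \<alpha>] T v \<alpha> mono by auto
        then have "((T + v) powr \<alpha> - v powr \<alpha>) * ((1 + v) powr \<alpha> - v powr \<alpha>) * v powr (- \<gamma>)
          \<le> T powr (\<alpha> + d) * 1 * v powr (- \<gamma>)"
          using inc by (intro mult_mono) auto
        then show ?thesis using True v by (simp add: h_def)
      next
        case False
        have "((T + v) powr \<alpha> - v powr \<alpha>) * ((1 + v) powr \<alpha> - v powr \<alpha>) * v powr (- \<gamma>)
          \<le> (T powr (\<alpha> + d) * v powr (- d)) * v powr (\<alpha> - 1) * v powr (- \<gamma>)"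
          using inc powr_increment_le_interpolated[of T v \<alpha> d] powr_add_le(2)[of 1 v \<alpha>] T v \<alpha> d
          by (intro mult_mono) auto
        also have "\<dots> = T powr (\<alpha> + d) * (v powr (- d) * v powr (\<alpha> - 1) * v powr (- \<gamma>))"
          by simp
        also have "v powr (- d) * v powr (\<alpha> - 1) * v powr (- \<gamma>) = h u"
          unfolding powr_add[symmetric] h_def using False v by (simp add: algebra_simps)
        finally show ?thesis .
      qed
      then show ?thesis
        using v T by (simp add: gfbm_kernel_product_neg)
    next
      case equal
      then show ?thesis by (simp add: gfbm_kernel_0 h_def)
    next
      case greater
      show ?thesis
      proof (cases "u < 1")
        case True
        have "(T - u) powr \<alpha> \<le> T powr \<alpha>" "(1 - u) powr \<alpha> \<le> 1 powr \<alpha>"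
          using True greater T \<alpha> by (auto intro!: powr_mono2 simp del: powr_one_eq_one)
        then have "(T - u) powr \<alpha> * (1 - u) powr \<alpha> * u powr (- \<gamma>) \<le> T powr (\<alpha> + d) * 1 * u powr (- \<gamma>)"
          using mono by (intro mult_mono) auto
        then show ?thesis
          using True T greater by (simp add: gfbm_kernel_product_pos h_def)
      next
        case False
        then show ?thesis using greater by (simp add: gfbm_kernel_product_pos h_def)
      qed
    qed
    \<comment> \<open>Integrability is supplied for the majorant: a non-integrable left side would
      have the default integral 0, which a nonnegative majorant dominates.\<close>
    then have "gfbm_cov \<alpha> \<gamma> T 1 \<le> (\<integral>u. T powr (\<alpha> + d) * h u \<partial>lborel)"
      unfolding gfbm_cov_def using h h0 by (intro integral_mono' integrable_mult_right) auto
    then show ?thesis by (simp add: mult.commute)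
  qed
  then show thesis by (rule that)
qed

text \<open>For \<alpha> \<le> 0 the kernel at T is dominated uniformly in T: (T-u)^\<alpha> \<le>
  (1-u)^\<alpha> on (0,1), and v^\<alpha> - (T+v)^\<alpha> \<le> v^\<alpha> for v = -u > 0. The
  singularity (1-u)^(2\<alpha>) at u = 1 is absorbed by \<open>int\<close>; at u = 0 the lower bound
  on \<alpha> gives 2 \<alpha> - \<gamma> > -1.\<close>

lemma gfbm_cov_upper_nonpos:
  assumes \<gamma>: "0 \<le> \<gamma>" "\<gamma> < 1" and \<alpha>: "- 1 / 2 + \<gamma> / 2 < \<alpha>" "\<alpha> \<le> 0"
    and int: "integrable lborel (\<lambda>u. gfbm_kernel \<alpha> \<gamma> 1 u * gfbm_kernel \<alpha> \<gamma> 1 u)"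
  obtains C where "\<And>T. 1 \<le> T \<Longrightarrow> gfbm_cov \<alpha> \<gamma> T 1 \<le> C"
proof -
  define h where "h u = (if \<bar>u\<bar> \<le> 1 then \<bar>u\<bar> powr (2 * \<alpha> - \<gamma>) else \<bar>u\<bar> powr (2 * \<alpha> - 1 - \<gamma>))"
    for u :: real
  \<comment> \<open>for \<open>\<alpha> = \<gamma> = 0\<close> the tail of \<open>h\<close> is not integrable, but then the kernels vanish on \<open>u < 0\<close>\<close>
  define k where "k u = gfbm_kernel \<alpha> \<gamma> 1 u * gfbm_kernel \<alpha> \<gamma> 1 u + (if \<alpha> = 0 then 0 else h u)" for u
  have h: "integrable lborel (\<lambda>u. if \<alpha> = 0 then 0 else h u)"
  proof (cases "\<alpha> = 0")
    case False
    then have "integrable lborel h"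
      unfolding h_def using \<gamma> \<alpha> by (intro integrable_two_power_tail) auto
    then show ?thesis using False by simp
  qed simp
  have h0: "0 \<le> h u" for u by (simp add: h_def)
  have sq0: "0 \<le> gfbm_kernel \<alpha> \<gamma> 1 u * gfbm_kernel \<alpha> \<gamma> 1 u" for u by simp
  have "gfbm_cov \<alpha> \<gamma> T 1 \<le> (\<integral>u. k u \<partial>lborel)" if T: "1 \<le> T" for T
  proof -
    have "gfbm_kernel \<alpha> \<gamma> T u * gfbm_kernel \<alpha> \<gamma> 1 u \<le> k u" for u
    proof (cases u "0::real" rule: linorder_cases)
      case less
      define v where "v = - u"
      then have v: "0 < v" "u = - v" using less by auto
      have dec: "(1 + v) powr \<alpha> \<le> v powr \<alpha>" "(T + v) powr \<alpha> \<le> v powr \<alpha>"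
        using v T \<alpha> by (auto intro!: powr_mono2')
      have eq: "gfbm_kernel \<alpha> \<gamma> T u * gfbm_kernel \<alpha> \<gamma> 1 u =
          (v powr \<alpha> - (T + v) powr \<alpha>) * (v powr \<alpha> - (1 + v) powr \<alpha>) * v powr (- \<gamma>)"
        using v T by (simp add: gfbm_kernel_product_neg algebra_simps)
      show ?thesis
      proof (cases "\<alpha> = 0")
        case True
        then show ?thesis using v T unfolding eq k_def by simp
      next
        case False
        have "(v powr \<alpha> - (T + v) powr \<alpha>) * (v powr \<alpha> - (1 + v) powr \<alpha>) * v powr (- \<gamma>) \<le> h u"
        proof (cases "v \<le> 1")
          case True
          have "(v powr \<alpha> - (T + v) powr \<alpha>) * (v powr \<alpha> - (1 + v) powr \<alpha>) * v powr (- \<gamma>)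
            \<le> v powr \<alpha> * v powr \<alpha> * v powr (- \<gamma>)"
            using dec by (intro mult_mono) auto
          also have "\<dots> = h u"
            unfolding powr_add[symmetric] h_def using True v by simp
          finally show ?thesis .
        next
          case False
          have "(v powr \<alpha> - (T + v) powr \<alpha>) * (v powr \<alpha> - (1 + v) powr \<alpha>) * v powr (- \<gamma>)
            \<le> v powr \<alpha> * v powr (\<alpha> - 1) * v powr (- \<gamma>)"
            using dec powr_neg_increment_le[of v \<alpha>] v \<alpha> \<gamma> by (intro mult_mono) auto
          also have "\<dots> = h u"
            unfolding powr_add[symmetric] h_def using False v by (simp add: algebra_simps)
          finally show ?thesis .
        qed
        then show ?thesis
          using False unfolding eq k_def by (simp add: add_increasing[OF sq0])
      qed
    next
      case equal
      then show ?thesis using h0 by (simp add: gfbm_kernel_0 k_def)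
    next
      case greater
      have "gfbm_kernel \<alpha> \<gamma> T u * gfbm_kernel \<alpha> \<gamma> 1 u \<le> gfbm_kernel \<alpha> \<gamma> 1 u * gfbm_kernel \<alpha> \<gamma> 1 u"
      proof (cases "u < 1")
        case True
        then show ?thesis
          using greater T \<alpha> by (auto simp: gfbm_kernel_product_pos intro!: mult_right_mono powr_mono2')
      next
        case False
        then show ?thesis using greater by (simp add: gfbm_kernel_product_pos)
      qed
      then show ?thesis using h0[of u] unfolding k_def by (intro order_trans[OF _ add_increasing2]) auto
    qed
    then show ?thesis
      unfolding gfbm_cov_def using h int sq0 h0
      by (intro integral_mono') (auto simp: k_def intro!: add_nonneg_nonneg)
  qed
  then show thesis by (rule that)
qed

lemma gfbm_cov_lower:
  assumes \<gamma>: "0 \<le> \<gamma>" and \<alpha>: "0 < \<alpha>" "\<alpha> \<le> 1"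
    and int: "\<And>T. 1 \<le> T \<Longrightarrow> integrable lborel (\<lambda>u. gfbm_kernel \<alpha> \<gamma> T u * gfbm_kernel \<alpha> \<gamma> 1 u)"
  obtains c where "0 < c" "\<And>T. 1 \<le> T \<Longrightarrow> c * T powr max \<alpha> (2 * \<alpha> - \<gamma>) \<le> gfbm_cov \<alpha> \<gamma> T 1"
proof -
  \<comment> \<open>For u in [1/4, 1/2]: T - u \<ge> T/2, 1 - u \<ge> 1/2 and u^(-\<gamma>) \<ge> 1;
    the division by 4 is the length of the interval.\<close>
  define c1 where "c1 = (1/2) powr \<alpha> * (1/2) powr \<alpha> / 4"
  \<comment> \<open>For v = -u in [T, 2T], T + v and 1 + v are at most 3T and v is at most 2T: two
    slopes taken at 3T and the weight at 2T. The remaining power T^(2\<alpha> - \<gamma> - 1) meets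
    an interval of length T.\<close>
  define c2 where "c2 = \<alpha> * 3 powr (\<alpha> - 1) * (\<alpha> * 3 powr (\<alpha> - 1)) * 2 powr (- \<gamma>)"
  have c: "0 < c1" "0 < c2" using \<alpha> by (auto simp: c1_def c2_def)
  have lower1: "c1 * T powr \<alpha> \<le> gfbm_cov \<alpha> \<gamma> T 1" if T: "1 \<le> T" for T
  proof -
    have "(4 * c1 * T powr \<alpha>) * measure lborel {1/4..1/2::real} \<le> gfbm_cov \<alpha> \<gamma> T 1"
      unfolding gfbm_cov_def
    proof (rule integral_ge_on_subset[OF int[OF T]])
      fix u :: real assume u: "u \<in> {1/4..1/2}"
      have "(T * (1/2)) powr \<alpha> \<le> (T - u) powr \<alpha>" "(1/2) powr \<alpha> \<le> (1 - u) powr \<alpha>"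
        using u T \<alpha> by (auto intro!: powr_mono2)
      moreover have "u powr 0 \<le> u powr (- \<gamma>)"
        using u \<gamma> by (intro powr_mono') auto
      ultimately have "(T * (1/2)) powr \<alpha> * (1/2) powr \<alpha> * 1 \<le>
          (T - u) powr \<alpha> * (1 - u) powr \<alpha> * u powr (- \<gamma>)"
        using u by (intro mult_mono) auto
      moreover have "(T * (1/2)) powr \<alpha> = T powr \<alpha> * (1/2) powr \<alpha>"
        using T by (intro powr_mult)
      ultimately show "4 * c1 * T powr \<alpha> \<le> gfbm_kernel \<alpha> \<gamma> T u * gfbm_kernel \<alpha> \<gamma> 1 u"
        using u T by (simp add: gfbm_kernel_product_pos c1_def mult_ac)
    qed (use T in \<open>auto intro: gfbm_kernel_product_nonneg\<close>)
    then show ?thesis by simp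
  qed
  have lower2: "c2 * T powr (2 * \<alpha> - \<gamma>) \<le> gfbm_cov \<alpha> \<gamma> T 1" if T: "1 \<le> T" for T
  proof -
    have "(c2 * T powr (2 * \<alpha> - \<gamma> - 1)) * measure lborel {- 2 * T..- T} \<le> gfbm_cov \<alpha> \<gamma> T 1"
      unfolding gfbm_cov_def
    proof (rule integral_ge_on_subset[OF int[OF T]])
      fix u :: real assume u: "u \<in> {- 2 * T..- T}"
      define v where "v = - u"
      then have v: "u = - v" "T \<le> v" "v \<le> 2 * T" "0 < v" using u T by auto
      have "\<alpha> * T * (3 * T) powr (\<alpha> - 1) \<le> \<alpha> * T * (T + v) powr (\<alpha> - 1)"
        using v T \<alpha> by (intro mult_left_mono powr_mono2') auto
      also have "\<dots> \<le> (T + v) powr \<alpha> - v powr \<alpha>"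
        using v T \<alpha> by (intro powr_increment_ge) auto
      finally have 1: "\<alpha> * T * (3 * T) powr (\<alpha> - 1) \<le> (T + v) powr \<alpha> - v powr \<alpha>" .
      have "\<alpha> * 1 * (3 * T) powr (\<alpha> - 1) \<le> \<alpha> * 1 * (1 + v) powr (\<alpha> - 1)"
        using v T \<alpha> by (intro mult_left_mono powr_mono2') auto
      also have "\<dots> \<le> (1 + v) powr \<alpha> - v powr \<alpha>"
        using v T \<alpha> by (intro powr_increment_ge) auto
      finally have 2: "\<alpha> * 1 * (3 * T) powr (\<alpha> - 1) \<le> (1 + v) powr \<alpha> - v powr \<alpha>" .
      have 3: "(2 * T) powr (- \<gamma>) \<le> v powr (- \<gamma>)"
        using v T \<gamma> by (intro powr_mono2') auto
      have "(\<alpha> * T * (3 * T) powr (\<alpha> - 1)) * (\<alpha> * 1 * (3 * T) powr (\<alpha> - 1)) * (2 * T) powr (- \<gamma>)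
        \<le> ((T + v) powr \<alpha> - v powr \<alpha>) * ((1 + v) powr \<alpha> - v powr \<alpha>) * v powr (- \<gamma>)"
        using \<alpha> T by (intro mult_mono 1 2 3 order_trans[OF _ 1] order_trans[OF _ 2] mult_nonneg_nonneg)
          auto
      also have "(\<alpha> * T * (3 * T) powr (\<alpha> - 1)) * (\<alpha> * 1 * (3 * T) powr (\<alpha> - 1)) * (2 * T) powr (- \<gamma>)
        = c2 * (T powr 1 * T powr (\<alpha> - 1) * T powr (\<alpha> - 1) * T powr (- \<gamma>))"
        using T by (simp add: powr_mult c2_def)
      also have "T powr 1 * T powr (\<alpha> - 1) * T powr (\<alpha> - 1) * T powr (- \<gamma>) = T powr (2 * \<alpha> - \<gamma> - 1)"
        unfolding powr_add[symmetric] by (simp add: algebra_simps)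
      finally show "c2 * T powr (2 * \<alpha> - \<gamma> - 1) \<le> gfbm_kernel \<alpha> \<gamma> T u * gfbm_kernel \<alpha> \<gamma> 1 u"
        using v T by (simp add: gfbm_kernel_product_neg)
    qed (use T in \<open>auto intro: gfbm_kernel_product_nonneg\<close>)
    also have "(c2 * T powr (2 * \<alpha> - \<gamma> - 1)) * measure lborel {- 2 * T..- T}
       = c2 * (T powr (2 * \<alpha> - \<gamma> - 1) * T powr 1)"
      using T by simp
    also have "T powr (2 * \<alpha> - \<gamma> - 1) * T powr 1 = T powr (2 * \<alpha> - \<gamma>)"
      unfolding powr_add[symmetric] by simp
    finally show ?thesis .
  qed
  show thesis
  proof (rule that)
    show "0 < min c1 c2" using c by simp
    fix T :: real assume T: "1 \<le> T"
    have "min c1 c2 * T powr \<alpha> \<le> c1 * T powr \<alpha>"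
      "min c1 c2 * T powr (2 * \<alpha> - \<gamma>) \<le> c2 * T powr (2 * \<alpha> - \<gamma>)"
      by (auto intro!: mult_right_mono)
    then show "min c1 c2 * T powr max \<alpha> (2 * \<alpha> - \<gamma>) \<le> gfbm_cov \<alpha> \<gamma> T 1"
      using lower1[OF T] lower2[OF T] by (auto simp: max_def)
  qed
qed

section \<open>Long-range dependence\<close>

text \<open>Squeezes ln f / t between ln c / t + m and ln C / t + m + e, with e arbitrary. The loss
  e matters because \<open>gfbm_cov_upper_pos\<close> excludes the endpoint d = \<alpha> -
  \<gamma>.\<close>

lemma exponential_rate_limit:
  fixes f :: "real \<Rightarrow> real"
  assumes c: "0 < c" "\<And>t. 0 \<le> t \<Longrightarrow> c * exp (m * t) \<le> f t"
    and upper: "\<And>e. 0 < e \<Longrightarrow> \<exists>C. \<forall>t\<ge>0. f t \<le> C * exp ((m + e) * t)"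
  shows "((\<lambda>t. ln (f t) / t) \<longlongrightarrow> m) at_top"
proof (rule order_tendstoI)
  fix a assume a: "a < m"
  have "((\<lambda>t. ln c / t) \<longlongrightarrow> 0) at_top"
    by (intro tendsto_divide_0[OF tendsto_const]) (simp add: filterlim_ident filterlim_at_top_imp_at_infinity)
  then have "\<forall>\<^sub>F t in at_top. a - m < ln c / t"
    using a by (intro order_tendstoD) auto
  then show "\<forall>\<^sub>F t in at_top. a < ln (f t) / t"
    using eventually_gt_at_top[of 0]
  proof eventually_elim
    case (elim t)
    have "ln c + m * t = ln (c * exp (m * t))" using c by (simp add: ln_mult)
    also have "\<dots> \<le> ln (f t)"
      using c(1) c(2)[of t] elim by (intro ln_mono) (auto intro: less_le_trans[OF _ c(2)])
    finally have "(ln c + m * t) / t \<le> ln (f t) / t"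
      using elim by (intro divide_right_mono) auto
    moreover have "(ln c + m * t) / t = ln c / t + m"
      using elim by (simp add: field_simps)
    ultimately show ?case using elim by linarith
  qed
next
  fix b assume b: "m < b"
  \<comment> \<open>Half of the gap pays for the loss in the exponent, the other half absorbs ln C /
    t.\<close>
  define e where "e = (b - m) / 2"
  have e: "0 < e" using b by (simp add: e_def)
  from upper[OF e] obtain C where C: "\<And>t. 0 \<le> t \<Longrightarrow> f t \<le> C * exp ((m + e) * t)" by blast
  have fpos: "0 < f t" if "0 \<le> t" for t
    using c that by (intro less_le_trans[OF _ c(2)]) auto
  have Cpos: "0 < C"
    using fpos[of 0] C[of 0] by simp
  have "((\<lambda>t. ln C / t) \<longlongrightarrow> 0) at_top"
    by (intro tendsto_divide_0[OF tendsto_const]) (simp add: filterlim_ident filterlim_at_top_imp_at_infinity)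
  then have "\<forall>\<^sub>F t in at_top. ln C / t < e"
    using e by (intro order_tendstoD) auto
  then show "\<forall>\<^sub>F t in at_top. ln (f t) / t < b"
    using eventually_gt_at_top[of 0]
  proof eventually_elim
    case (elim t)
    have "ln (f t) \<le> ln (C * exp ((m + e) * t))"
      using fpos[of t] C[of t] elim by (intro ln_mono) auto
    also have "\<dots> = ln C + (m + e) * t" using Cpos by (simp add: ln_mult)
    finally have "ln (f t) / t \<le> (ln C + (m + e) * t) / t"
      using elim by (intro divide_right_mono) auto
    moreover have "(ln C + (m + e) * t) / t = ln C / t + m + e"
      using elim by (simp add: field_simps)
    moreover have "b = m + e + e" by (simp add: e_def)
    ultimately show ?case using elim by linarith
  qed
qed

section \<open>Covariance of X and of its Lamperti transform\<close>

lemma gfbm_covariance: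
  assumes B: "gaussian_random_measure M lborel B" and X: "generalized_fBm M B \<alpha> \<gamma> X"
    and st: "0 \<le> s" "0 \<le> t"
  shows "integrable M (\<lambda>\<omega>. X s \<omega> * X t \<omega>)"
    and "(\<integral>\<omega>. X s \<omega> * X t \<omega> \<partial>M) = (gfbm_const \<alpha> \<gamma>)\<^sup>2 * gfbm_cov \<alpha> \<gamma> s t"
    and "integrable lborel (\<lambda>u. gfbm_kernel \<alpha> \<gamma> s u * gfbm_kernel \<alpha> \<gamma> t u)"
proof -
  from X st obtain I J where
    I: "has_wiener_integral M lborel B (gfbm_kernel \<alpha> \<gamma> s) I"
       "\<And>\<omega>. \<omega> \<in> space M \<Longrightarrow> X s \<omega> = gfbm_const \<alpha> \<gamma> * I \<omega>" and
    J: "has_wiener_integral M lborel B (gfbm_kernel \<alpha> \<gamma> t) J"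
       "\<And>\<omega>. \<omega> \<in> space M \<Longrightarrow> X t \<omega> = gfbm_const \<alpha> \<gamma> * J \<omega>"
    unfolding generalized_fBm_def by metis
  note iso = wiener_integral_isometry[OF B I(1) J(1)]
  have eq: "X s \<omega> * X t \<omega> = (gfbm_const \<alpha> \<gamma>)\<^sup>2 * (I \<omega> * J \<omega>)" if "\<omega> \<in> space M" for \<omega>
    using I(2)[OF that] J(2)[OF that] by (simp add: power2_eq_square)
  show "integrable lborel (\<lambda>u. gfbm_kernel \<alpha> \<gamma> s u * gfbm_kernel \<alpha> \<gamma> t u)" by (rule iso)
  show "integrable M (\<lambda>\<omega>. X s \<omega> * X t \<omega>)"
    using iso(1) by (subst Bochner_Integration.integrable_cong[OF refl eq]) simp_all
  show "(\<integral>\<omega>. X s \<omega> * X t \<omega> \<partial>M) = (gfbm_const \<alpha> \<gamma>)\<^sup>2 * gfbm_cov \<alpha> \<gamma> s t"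
    unfolding gfbm_cov_def using iso(3)
    by (subst Bochner_Integration.integral_cong[OF refl eq]) simp_all
qed

text \<open>The factor e^(-2Hs) of the Lamperti transform cancels the e^(2Hs) from the homogeneity
  of K, whence stationarity. The equivalence determines C uniquely and so eliminates the quantifier
  over C in \<open>long_range_dependent\<close>.\<close>

lemma gfbm_lamperti_covariance:
  assumes B: "gaussian_random_measure M lborel B" and X: "generalized_fBm M B \<alpha> \<gamma> X"
    and H: "H = \<alpha> - \<gamma> / 2 + 1 / 2"
  shows "has_covariance_function M (lamperti H X) C \<longleftrightarrow>
    C = (\<lambda>t. exp (- H * t) * ((gfbm_const \<alpha> \<gamma>)\<^sup>2 * gfbm_cov \<alpha> \<gamma> (exp t) 1))"
proof -
  have eq: "lamperti H X (t + s) \<omega> * lamperti H X s \<omega> =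
      exp (- H * t) * exp (s * (- 2 * H)) * (X (exp (t + s)) \<omega> * X (exp s) \<omega>)" for s t \<omega>
  proof -
    have "exp (- H * t) * exp (s * (- 2 * H)) = exp (- H * (t + s)) * exp (- H * s)"
      by (simp add: algebra_simps flip: exp_add)
    then show ?thesis by (simp add: lamperti_def)
  qed
  have scale: "gfbm_cov \<alpha> \<gamma> (exp (t + s)) (exp s) = exp (s * (2 * H)) * gfbm_cov \<alpha> \<gamma> (exp t) 1"
    for s t
    using gfbm_cov_scale[of "exp s" \<alpha> \<gamma> "exp t" 1]
    by (simp add: H powr_def exp_add mult_ac)
  have "integrable M (\<lambda>\<omega>. lamperti H X (t + s) \<omega> * lamperti H X s \<omega>)" for s t
    unfolding eq using gfbm_covariance(1)[OF B X] by (intro integrable_mult_right) auto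
  moreover have "(\<integral>\<omega>. lamperti H X (t + s) \<omega> * lamperti H X s \<omega> \<partial>M) =
      exp (- H * t) * ((gfbm_const \<alpha> \<gamma>)\<^sup>2 * gfbm_cov \<alpha> \<gamma> (exp t) 1)" for s t
    unfolding eq integral_mult_right_zero using gfbm_covariance(2)[OF B X, of "exp (t + s)" "exp s"]
    by (simp add: scale exp_minus)
  ultimately show ?thesis
    unfolding has_covariance_function_def by (auto simp: fun_eq_iff)
qed

section \<open>The threshold \<alpha> = 0\<close>

lemma gfbm_long_range_dependent_iff:
  assumes B: "gaussian_random_measure M lborel B"
    and \<gamma>: "0 \<le> \<gamma>" "\<gamma> < 1" and \<alpha>: "- 1 / 2 + \<gamma> / 2 < \<alpha>" "\<alpha> < 1 / 2 + \<gamma> / 2"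
    and X: "generalized_fBm M B \<alpha> \<gamma> X"
  shows "long_range_dependent M (\<alpha> - \<gamma> / 2 + 1 / 2) X \<longleftrightarrow> 0 < \<alpha>"
proof -
  define H where "H = \<alpha> - \<gamma> / 2 + 1 / 2"
  define f where "f t = (gfbm_const \<alpha> \<gamma>)\<^sup>2 * gfbm_cov \<alpha> \<gamma> (exp t) 1" for t
  note int = gfbm_covariance(3)[OF B X]
  have k: "0 < (gfbm_const \<alpha> \<gamma>)\<^sup>2"
    using gfbm_const_pos[OF \<gamma> \<alpha>(2) int] by simp
  \<comment> \<open>Disposes of the absolute value: where f is nonzero it is positive, as
    \<open>rate\<close> requires.\<close>
  have f0: "0 \<le> f t" for t
    unfolding f_def gfbm_cov_def
    by (intro mult_nonneg_nonneg Bochner_Integration.integral_nonneg gfbm_kernel_product_nonneg) auto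
  \<comment> \<open>The factor e^(-Ht) contributes -H after division by t, which the summand H
    offsets; the growth rate of f is left.\<close>
  have rate: "1 / t * ln \<bar>exp (- H * t) * f t\<bar> + H = ln (f t) / t" if "0 < f t" "0 < t" for t
    using that by (simp add: abs_mult ln_mult field_simps)
  have lrd: "long_range_dependent M H X \<longleftrightarrow> (\<forall>\<^sub>F t in at_top. f t \<noteq> 0) \<and>
      (\<exists>L>0. ((\<lambda>t. ln (f t) / t) \<longlongrightarrow> L) at_top)"
  proof -
    have "((\<lambda>t. 1 / t * ln \<bar>exp (- H * t) * f t\<bar> + H) \<longlongrightarrow> L) at_top \<longleftrightarrow>
        ((\<lambda>t. ln (f t) / t) \<longlongrightarrow> L) at_top" if "\<forall>\<^sub>F t in at_top. f t \<noteq> 0" for L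
    proof (rule tendsto_cong)
      show "\<forall>\<^sub>F t in at_top. 1 / t * ln \<bar>exp (- H * t) * f t\<bar> + H = ln (f t) / t"
        using that eventually_gt_at_top[of 0]
      proof eventually_elim
        case (elim t)
        then show ?case using f0[of t] by (intro rate) auto
      qed
    qed
    then show ?thesis
      unfolding long_range_dependent_def gfbm_lamperti_covariance[OF B X H_def] f_def[symmetric]
      by auto
  qed
  show ?thesis
  proof (cases "0 < \<alpha>")
    case True
    have \<alpha>1: "\<alpha> \<le> 1" using \<alpha> \<gamma> by simp
    define m where "m = max \<alpha> (2 * \<alpha> - \<gamma>)"
    obtain c where c: "0 < c" "\<And>T. 1 \<le> T \<Longrightarrow> c * T powr m \<le> gfbm_cov \<alpha> \<gamma> T 1"
      using gfbm_cov_lower[OF \<gamma>(1) True \<alpha>1 int] unfolding m_def by (metis dual_order.trans zero_le_one)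
    have lower: "(gfbm_const \<alpha> \<gamma>)\<^sup>2 * c * exp (m * t) \<le> f t" if "0 \<le> t" for t
      using c(2)[of "exp t"] that k unfolding f_def by (simp add: powr_def mult.assoc)
    have upper: "\<exists>C. \<forall>t\<ge>0. f t \<le> C * exp ((m + e) * t)" if e: "0 < e" for e
    proof -
      \<comment> \<open>Since m - \<alpha> = max 0 (\<alpha> - \<gamma>), the first entry exceeds
        \<alpha> - \<gamma>. The cap 1 - \<alpha> is the range of the interpolation, and it exceeds
        \<alpha> - \<gamma> too because \<alpha> < 1/2 + \<gamma>/2.\<close>
      define d where "d = min (m - \<alpha> + e) (1 - \<alpha>)"
      have d: "0 \<le> d" "d \<le> 1 - \<alpha>" "\<alpha> - \<gamma> < d" "\<alpha> + d \<le> m + e"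
        using e \<alpha> \<gamma> \<alpha>1 by (auto simp: d_def m_def)
      obtain C where C: "\<And>T. 1 \<le> T \<Longrightarrow> gfbm_cov \<alpha> \<gamma> T 1 \<le> C * T powr (\<alpha> + d)"
        using gfbm_cov_upper_pos[OF \<gamma> True \<alpha>1 d(1-3)] by blast
      have "f t \<le> (gfbm_const \<alpha> \<gamma>)\<^sup>2 * \<bar>C\<bar> * exp ((m + e) * t)" if t: "0 \<le> t" for t
      proof -
        have "gfbm_cov \<alpha> \<gamma> (exp t) 1 \<le> C * exp ((\<alpha> + d) * t)"
          using C[of "exp t"] t by (simp add: powr_def)
        also have "\<dots> \<le> \<bar>C\<bar> * exp ((m + e) * t)"
          using d t by (intro mult_mono) (auto intro: mult_right_mono)
        finally show ?thesis
          using k unfolding f_def by (simp add: mult.assoc)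
      qed
      then show ?thesis by blast
    qed
    have kc: "0 < (gfbm_const \<alpha> \<gamma>)\<^sup>2 * c" using k c by simp
    have "\<forall>\<^sub>F t in at_top. f t \<noteq> 0"
      using eventually_ge_at_top[of 0]
    proof eventually_elim
      case (elim t)
      have "0 < (gfbm_const \<alpha> \<gamma>)\<^sup>2 * c * exp (m * t)" using kc by simp
      then show ?case using lower[OF elim] by linarith
    qed
    moreover have "0 < m" using True by (simp add: m_def)
    moreover have "((\<lambda>t. ln (f t) / t) \<longlongrightarrow> m) at_top"
      using kc lower upper by (rule exponential_rate_limit)
    ultimately show ?thesis using True lrd unfolding H_def by blast
  next
    case False
    then have \<alpha>0: "\<alpha> \<le> 0" by simp
    obtain C where C: "\<And>T. 1 \<le> T \<Longrightarrow> gfbm_cov \<alpha> \<gamma> T 1 \<le> C"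
      using gfbm_cov_upper_nonpos[OF \<gamma> \<alpha>(1) \<alpha>0 int] by auto
    \<comment> \<open>D \<ge> 1 keeps ln D nonnegative, so \<open>ln (f t) \<le> ln D\<close>
      survives at zeros of f, where \<open>ln 0 = 0\<close>.\<close>
    define D where "D = max 1 ((gfbm_const \<alpha> \<gamma>)\<^sup>2 * C)"
    have fD: "f t \<le> D" if "0 \<le> t" for t
      using C[of "exp t"] that k by (simp add: f_def D_def le_max_iff_disj)
    \<comment> \<open>The rate of a bounded f is at most ln D / t, whose limit is 0.\<close>
    have False if L: "0 < L" "((\<lambda>t. ln (f t) / t) \<longlongrightarrow> L) at_top" for L
    proof -
      have "((\<lambda>t. ln D / t) \<longlongrightarrow> 0) at_top"
        by (intro tendsto_divide_0[OF tendsto_const])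
          (simp add: filterlim_ident filterlim_at_top_imp_at_infinity)
      moreover have "\<forall>\<^sub>F t in at_top. ln (f t) / t \<le> ln D / t"
        using eventually_gt_at_top[of 0]
      proof eventually_elim
        case (elim t)
        have "ln (f t) \<le> ln D"
        proof (cases "f t = 0")
          case True
          then show ?thesis by (simp add: D_def)
        next
          case False
          then show ?thesis using f0[of t] fD[of t] elim by (intro ln_mono) auto
        qed
        then show ?case using elim by (intro divide_right_mono) auto
      qed
      ultimately have "L \<le> 0"
        using L(2) by (intro tendsto_le[of at_top]) auto
      then show False using L by simp
    qed
    then show ?thesis using False lrd unfolding H_def by blast
  qed
qed

theorem proposition5p1:
  fixes M :: "'a measure"
    and B :: "real set \<Rightarrow> 'a \<Rightarrow> real"
    and X :: "real \<Rightarrow> 'a \<Rightarrow> real"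
    and \<alpha> \<gamma> :: real
  assumes "gaussian_random_measure M lborel B"
    and "0 \<le> \<gamma>" and "\<gamma> < 1"
    and "- 1 / 2 + \<gamma> / 2 < \<alpha>" and "\<alpha> < 1 / 2 + \<gamma> / 2"
    and "generalized_fBm M B \<alpha> \<gamma> X"
  shows "(long_range_dependent M (\<alpha> - \<gamma> / 2 + 1 / 2) X \<longleftrightarrow> \<alpha> > 0) \<and>
         (\<forall>H Y. 0 < H \<and> H < 1 \<and> fractional_BM M B H Y \<longrightarrow> H > 1 / 2 \<longrightarrow>
            long_range_dependent M H Y)"
proof (intro conjI allI impI)
  show "long_range_dependent M (\<alpha> - \<gamma> / 2 + 1 / 2) X \<longleftrightarrow> \<alpha> > 0"
    using assms by (rule gfbm_long_range_dependent_iff)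
next
  fix H Y
  assume "0 < H \<and> H < 1 \<and> fractional_BM M B H Y" "H > 1 / 2"
  \<comment> \<open>With \<gamma> = 0 and \<alpha> = H - 1/2 the Hurst index of the general case is
    H itself, and 0 < H < 1 is the admissible range of \<alpha>.\<close>
  then show "long_range_dependent M H Y"
    using gfbm_long_range_dependent_iff[OF assms(1), of 0 "H - 1 / 2" Y]
    by (simp add: fractional_BM_def)
qed

end
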